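(* The implication groupoid $2_{13}$, i.e. the groupoid on $\{0,1\}$ with binary operation $\diamond$ given by $0\diamond 0=0\diamond 1=1\diamond 1=1$ and $1\diamond 0=0$, is completely dissociative.
   Context: A groupoid $\langle G;\diamond\rangle$ is a set $G$ with a binary operation $\diamond$ on $G$. $\mathbf{N}=\{1,2,3,\ldots\}$, and $G^\omega$ is the set of infinite sequences $\vec g=g_0g_1g_2\ldots$ of elements of $G$. For $k\in\mathbf{N}$, $F^\sigma(k)$ is the set of formal $k$-products: the finite words $\mathbf{u}$ over the alphabet $\{\bullet,x_0,x_1,x_2,\ldots\}$ such that (1) $x_0x_1\ldots x_{k-1}$ is a subsequence of $\mathbf{u}$; (2) $\mathbf{u}$ has length $2k-1$; (3) $\bullet$ occurs exactly $k-1$ times in $\mathbf{u}$; (4) in every nonempty prefix of $\mathbf{u}$ the number of occurrences of $\bullet$ is strictly less than the number of other letters. These are exactly the reverse Polish forms of the full parenthesizations of $x_0x_1\ldots x_{k-1}$ (each variable once, in this order). For $\mathbf{u}\in F^\sigma(k)$ and $\vec g\in G^\omega$, $\vec g\,\mathbf{u}^\diamond\in G$ is the element obtained by replacing each $x_i$ in $\mathbf{u}$ by $g_i$ and each $\bullet$ by $\diamond$ and evaluating in reverse Polish notation ($ab\diamond$ means $a\diamond b$). $\langle G;\diamond\rangle$ is $k$-dissociative iff for every pair $\mathbf{u}\neq\mathbf{v}$ in $F^\sigma(k)$ there is $\vec g\in G^\omega$ with $\vec g\,\mathbf{u}^\diamond\neq\vec g\,\mathbf{v}^\diamond$. It is completely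 dissociative iff it is $k$-dissociative for every $k\ge 3$. *)

theory Defs
  imports "HOL-Library.Sublist"
begin

datatype symb = Bullet | X nat

text \<open>The condition \<open>k \<ge> 1\<close> is built in because \<open>k\<close> ranges over \<open>{1,2,3,\<dots>}\<close>; it also
  makes both occurrences of truncated subtraction harmless.\<close>

definition formal_products :: "nat \<Rightarrow> symb list set" where
  "formal_products k = {u. k \<ge> 1
     \<and> subseq (map X [0..<k]) u
     \<and> length u = 2 * k - 1
     \<and> count_list u Bullet = k - 1
     \<and> (\<forall>p. prefix p u \<and> p \<noteq> [] \<longrightarrow>
            count_list p Bullet < length (filter (\<lambda>s. s \<noteq> Bullet) p))}"

text \<open>Reverse Polish evaluation on a stack whose top is the head of the list, so on reading
  \<open>Bullet\<close> the right operand is popped first. Stack underflow never happens for formal products,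
  which evaluate to a one-element stack (lemma \<open>formal_product_stack\<close>).\<close>

fun rpn_step :: "('a \<Rightarrow> 'a \<Rightarrow> 'a) \<Rightarrow> (nat \<Rightarrow> 'a) \<Rightarrow> symb \<Rightarrow> 'a list \<Rightarrow> 'a list" where
  "rpn_step f g (X i) st = g i # st"
| "rpn_step f g Bullet (b # a # st) = f a b # st"
| "rpn_step f g Bullet st = undefined"

definition rpn_value :: "('a \<Rightarrow> 'a \<Rightarrow> 'a) \<Rightarrow> (nat \<Rightarrow> 'a) \<Rightarrow> symb list \<Rightarrow> 'a" where
  "rpn_value f g u = hd (fold (rpn_step f g) u [])"

definition groupoid :: "'a set \<Rightarrow> ('a \<Rightarrow> 'a \<Rightarrow> 'a) \<Rightarrow> bool" where
  "groupoid G f \<longleftrightarrow> (\<forall>a\<in>G. \<forall>b\<in>G. f a b \<in> G)"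

definition dissociative :: "nat \<Rightarrow> 'a set \<Rightarrow> ('a \<Rightarrow> 'a \<Rightarrow> 'a) \<Rightarrow> bool" where
  "dissociative k G f \<longleftrightarrow>
     (\<forall>u\<in>formal_products k. \<forall>v\<in>formal_products k. u \<noteq> v \<longrightarrow>
        (\<exists>g. (\<forall>i. g i \<in> G) \<and> rpn_value f g u \<noteq> rpn_value f g v))"

definition completely_dissociative :: "'a set \<Rightarrow> ('a \<Rightarrow> 'a \<Rightarrow> 'a) \<Rightarrow> bool" where
  "completely_dissociative G f \<longleftrightarrow> (\<forall>k\<ge>3. dissociative k G f)"

text \<open>The implication groupoid has carrier \<open>{0,1}\<close>; values outside the carrier are irrelevant.\<close>

definition imp_op :: "nat \<Rightarrow> nat \<Rightarrow> nat" where
  "imp_op a b = (if a = 1 \<and> b = 0 then 0 else 1)"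

lemma imp_op_table:
  "imp_op 0 0 = 1" "imp_op 0 1 = 1" "imp_op 1 1 = 1" "imp_op 1 0 = 0"
  by (simp_all add: imp_op_def)

lemma groupoid_imp_op: "groupoid {0, 1} imp_op"
  by (simp add: groupoid_def imp_op_def)

lemma count_list_plus_filter:
  "count_list u Bullet + length (filter (\<lambda>s. s \<noteq> Bullet) u) = length u"
  by (induction u) auto

lemma rpn_stack_length:
  assumes "\<And>p. prefix p u \<Longrightarrow> p \<noteq> [] \<Longrightarrow>
             count_list p Bullet < length (filter (\<lambda>s. s \<noteq> Bullet) p)"
  shows "length (fold (rpn_step f g) u []) + count_list u Bullet
           = length (filter (\<lambda>s. s \<noteq> Bullet) u)"
  using assms
proof (induction u rule: rev_induct)
  case Nil
  then show ?case by simp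
next
  case (snoc s u)
  let ?st = "fold (rpn_step f g) u []"
  have IH: "length ?st + count_list u Bullet = length (filter (\<lambda>s. s \<noteq> Bullet) u)"
    using snoc by (meson prefix_order.trans prefixI)
  have *: "count_list (u @ [s]) Bullet < length (filter (\<lambda>s. s \<noteq> Bullet) (u @ [s]))"
    by (rule snoc.prems) simp_all
  show ?case
  proof (cases s)
    case Bullet
    with * IH have "2 \<le> length ?st" by simp
    then obtain b a st where "?st = b # a # st"
      by (metis Suc_le_length_iff numeral_2_eq_2)
    with Bullet IH show ?thesis by simp
  next
    case (X i)
    with IH show ?thesis by simp
  qed
qed

lemma formal_product_stack:
  assumes "u \<in> formal_products k"
  shows "fold (rpn_step f g) u [] = [rpn_value f g u]"
proof -
  have "length (fold (rpn_step f g) u []) + count_list u Bullet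
          = length (filter (\<lambda>s. s \<noteq> Bullet) u)"
    using assms by (intro rpn_stack_length) (auto simp: formal_products_def)
  then have "length (fold (rpn_step f g) u []) = 1"
    using assms count_list_plus_filter[of u] by (auto simp: formal_products_def)
  then show ?thesis
    by (auto simp: rpn_value_def length_Suc_conv)
qed

end

theory Submission
  imports Defs
begin

text \<open>
  Read \<open>0\<close> as false and \<open>1\<close> as true, so that the operation is implication. Each formal
  product is the postfix form of a binary tree (lemma \<open>formal_product_parse\<close>), so it suffices to
  recover an implication tree from the function it computes.

  The rightmost leaf of a tree controls its value: if it is true, so is the whole tree; if it is
  false and every other leaf is true, the tree is false (lemmas \<open>eval_imp_last_true\<close> and
  \<open>eval_imp_last_only_false\<close>). Let two trees \<open>l \<rightarrow> r\<close> and \<open>l' \<rightarrow> r'\<close> have the same leaves in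
  the same order, without repetition. If \<open>l\<close> is shorter than \<open>l'\<close>, make exactly the last leaf of \<open>l\<close> and the last
  leaf of the whole product false. Then \<open>l\<close> is false, so \<open>l \<rightarrow> r\<close> is true; but \<open>l'\<close> is true and
  \<open>r'\<close> is false, so \<open>l' \<rightarrow> r'\<close> is false. Hence the function determines where the root splits the
  leaves (lemma \<open>eval_imp_determines_split\<close>). With the split known, making \<open>l\<close> true leaves the
  function of \<open>r\<close>, and making \<open>r\<close> false leaves the negation of the function of \<open>l\<close>; induction on
  the tree finishes the argument (lemma \<open>eval_imp_inj\<close>).
\<close>

section \<open>Formal products as binary trees\<close>

datatype tree = Leaf nat | Node tree tree

fun leaves :: "tree \<Rightarrow> nat list" where
  "leaves (Leaf i) = [i]"
| "leaves (Node l r) = leaves l @ leaves r"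

fun postfix :: "tree \<Rightarrow> symb list" where
  "postfix (Leaf i) = [X i]"
| "postfix (Node l r) = postfix l @ postfix r @ [Bullet]"

fun eval_tree :: "('a \<Rightarrow> 'a \<Rightarrow> 'a) \<Rightarrow> (nat \<Rightarrow> 'a) \<Rightarrow> tree \<Rightarrow> 'a" where
  "eval_tree f g (Leaf i) = g i"
| "eval_tree f g (Node l r) = f (eval_tree f g l) (eval_tree f g r)"

lemma leaves_nonempty [simp]: "leaves t \<noteq> []"
  by (induction t) auto

lemma filter_postfix: "filter (\<lambda>s. s \<noteq> Bullet) (postfix t) = map X (leaves t)"
  by (induction t) auto

lemma fold_rpn_step_postfix:
  "fold (rpn_step f g) (postfix t) st = eval_tree f g t # st"
  by (induction t arbitrary: st) auto

lemma rpn_value_postfix: "rpn_value f g (postfix t) = eval_tree f g t"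
  by (simp add: rpn_value_def fold_rpn_step_postfix)

lemma eval_tree_cong:
  "(\<And>i. i \<in> set (leaves t) \<Longrightarrow> g i = h i) \<Longrightarrow> eval_tree f g t = eval_tree f h t"
  by (induction t) auto

text \<open>Parsing is itself reverse Polish evaluation, carried out in the groupoid of trees: the
  stack always holds the parses of consecutive segments of the input, the last segment on top.\<close>

lemma postfix_of_parse_stack:
  assumes "\<And>p. prefix p u \<Longrightarrow> p \<noteq> [] \<Longrightarrow>
             count_list p Bullet < length (filter (\<lambda>s. s \<noteq> Bullet) p)"
  shows "concat (map postfix (rev (fold (rpn_step Node Leaf) u []))) = u"
  using assms
proof (induction u rule: rev_induct)
  case Nil
  then show ?case by simp
next
  case (snoc s u)
  let ?st = "fold (rpn_step Node Leaf) u []"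
  have prefixes: "count_list p Bullet < length (filter (\<lambda>s. s \<noteq> Bullet) p)"
    if "prefix p u" "p \<noteq> []" for p
    using that snoc.prems by simp
  have IH: "concat (map postfix (rev ?st)) = u"
    using snoc.IH prefixes by blast
  show ?case
  proof (cases s)
    case Bullet
    have "length ?st + count_list u Bullet = length (filter (\<lambda>s. s \<noteq> Bullet) u)"
      using prefixes by (rule rpn_stack_length)
    moreover have "count_list (u @ [s]) Bullet < length (filter (\<lambda>s. s \<noteq> Bullet) (u @ [s]))"
      by (rule snoc.prems) simp_all
    ultimately have "2 \<le> length ?st"
      using Bullet by simp
    then obtain b a st where "?st = b # a # st"
      by (metis Suc_le_length_iff numeral_2_eq_2)
    with Bullet IH show ?thesis by simp
  next
    case (X i)
    with IH show ?thesis by simp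
  qed
qed

lemma formal_product_parse:
  assumes "u \<in> formal_products k"
  obtains t where "u = postfix t" "leaves t = [0..<k]"
proof -
  define t where "t = rpn_value Node Leaf u"
  have "concat (map postfix (rev (fold (rpn_step Node Leaf) u []))) = u"
    using assms by (intro postfix_of_parse_stack) (auto simp: formal_products_def)
  then have u: "u = postfix t"
    using formal_product_stack[OF assms, of Node Leaf] by (simp add: t_def)
  \<comment> \<open>There are only \<open>k\<close> letters other than \<open>Bullet\<close>, so the subsequence \<open>x\<^sub>0 \<dots> x\<^sub>k\<^sub>-\<^sub>1\<close> uses all of them.\<close>
  let ?P = "\<lambda>s. s \<noteq> Bullet"
  have "filter ?P (map X [0..<k]) = map X [0..<k]"
    by (simp add: filter_map comp_def)
  moreover have "subseq (filter ?P (map X [0..<k])) (filter ?P u)"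
    using assms by (intro subseq_filter) (simp add: formal_products_def)
  ultimately have "subseq (map X [0..<k]) (filter ?P u)"
    by simp
  moreover have "length (filter ?P u) = k"
    using assms count_list_plus_filter[of u] by (auto simp: formal_products_def)
  ultimately have "map X [0..<k] = filter ?P u"
    using subseq_same_length by fastforce
  then have "map X (leaves t) = map X [0..<k]"
    using u filter_postfix by simp
  then have "leaves t = [0..<k]"
    using list.inj_map_strong[of "leaves t" "[0..<k]" X X] by simp
  with u show thesis by (rule that)
qed

section \<open>Recovering an implication tree from its truth function\<close>

abbreviation eval_imp :: "(nat \<Rightarrow> nat) \<Rightarrow> tree \<Rightarrow> nat" where
  "eval_imp \<equiv> eval_tree imp_op"

definition false_at :: "nat set \<Rightarrow> nat \<Rightarrow> nat" where
  "false_at A i = (if i \<in> A then 0 else 1)"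

lemma false_at_carrier: "false_at A i \<in> {0, 1}"
  by (simp add: false_at_def)

lemma eval_imp_carrier:
  "(\<And>i. g i \<in> {0, 1}) \<Longrightarrow> eval_imp g t \<in> {0, 1}"
  by (cases t) (auto simp: imp_op_def)

lemma eval_imp_last_true: "g (last (leaves t)) = 1 \<Longrightarrow> eval_imp g t = 1"
  by (induction t) (auto simp: imp_op_def)

text \<open>Along the right spine all premises are true, by \<open>eval_imp_last_true\<close>: distinctness of the
  leaves keeps the false leaf out of them.\<close>

lemma eval_imp_last_only_false:
  assumes "distinct (leaves t)"
    and "g (last (leaves t)) = 0"
    and "\<And>i. i \<in> set (leaves t) \<Longrightarrow> i \<noteq> last (leaves t) \<Longrightarrow> g i = 1"
  shows "eval_imp g t = 0"
  using assms
proof (induction t)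
  case (Leaf i)
  then show ?case by simp
next
  case (Node l r)
  have "set (leaves l) \<inter> set (leaves r) = {}"
    using Node.prems(1) by simp
  then have "last (leaves l) \<noteq> last (leaves r)"
    by (metis disjoint_iff last_in_set leaves_nonempty)
  then have "eval_imp g l = 1"
    using Node.prems(3) by (intro eval_imp_last_true) simp
  moreover have "eval_imp g r = 0"
    using Node by simp
  ultimately show ?case
    by (simp only: eval_tree.simps imp_op_table)
qed

text \<open>The last leaf of \<open>l\<close> can make \<open>l\<close> false, but in \<open>l'\<close> it is an inner leaf, masked as soon
  as the last leaf of \<open>l'\<close> is true. Making the last leaf of the whole product false as well
  exposes the difference between the two premises.\<close>

lemma eval_imp_determines_split:
  assumes distinct: "distinct (leaves (Node l r))"
    and l': "leaves l' = leaves l @ us"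
    and r: "leaves r = us @ leaves r'"
    and "us \<noteq> []"
  defines "g \<equiv> false_at {last (leaves l), last (leaves r)}"
  shows "eval_imp g (Node l r) = 1" "eval_imp g (Node l' r') = 0"
proof -
  have last: "last (leaves r) = last (leaves r')" "last (leaves l') = last us"
    using l' r \<open>us \<noteq> []\<close> by simp_all
  have "set (leaves l) \<inter> set us = {}" "set us \<inter> set (leaves r') = {}"
      "set (leaves l) \<inter> set (leaves r') = {}"
    using distinct r by auto
  then have notin: "last us \<noteq> last (leaves l)" "last us \<noteq> last (leaves r')"
      "last (leaves r') \<notin> set (leaves l)" "last (leaves l) \<notin> set (leaves r')"
    by (metis \<open>us \<noteq> []\<close> disjoint_iff last_in_set leaves_nonempty)+
  have "eval_imp g l = 0"
    using distinct notin last
    by (intro eval_imp_last_only_false) (auto simp: g_def false_at_def)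
  then show "eval_imp g (Node l r) = 1"
    by (simp add: imp_op_def)
  have "eval_imp g l' = 1"
    using distinct notin last r
    by (intro eval_imp_last_true) (auto simp: g_def false_at_def)
  moreover have "eval_imp g r' = 0"
    using distinct notin last r
    by (intro eval_imp_last_only_false) (auto simp: g_def false_at_def)
  ultimately show "eval_imp g (Node l' r') = 0"
    by (simp add: imp_op_def)
qed

text \<open>The two subtrees share no leaf, so the values of one can be fixed while the other is
  compared on arbitrary assignments.\<close>

lemma eval_imp_inj:
  assumes "distinct (leaves t)"
    and "leaves t = leaves t'"
    and "\<And>g. (\<And>i. g i \<in> {0, 1}) \<Longrightarrow> eval_imp g t = eval_imp g t'"
  shows "t = t'"
  using assms
proof (induction t arbitrary: t')
  case (Leaf i)
  then show ?case
    by (cases t') (auto simp: Cons_eq_append_conv)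
next
  case (Node l r)
  from Node.prems(2) obtain l' r' where t': "t' = Node l' r'"
    by (cases t') (auto simp: append_eq_Cons_conv)
  have leaves: "leaves l @ leaves r = leaves l' @ leaves r'"
    using Node.prems(2) t' by simp
  have eq: "eval_imp g (Node l r) = eval_imp g (Node l' r')" if "\<And>i. g i \<in> {0, 1}" for g
    using Node.prems(3)[OF that] t' by simp
  have distinct': "distinct (leaves (Node l' r'))"
    using Node.prems(1,2) t' by metis
  from leaves obtain us where
    us: "leaves l = leaves l' @ us \<and> us @ leaves r = leaves r' \<or>
         leaves l @ us = leaves l' \<and> leaves r = us @ leaves r'"
    unfolding append_eq_append_conv2 by blast
  have "us = []"
  proof (rule ccontr)
    assume "us \<noteq> []"
    from us show False
    proof
      assume "leaves l = leaves l' @ us \<and> us @ leaves r = leaves r'"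
      then show False
        using eval_imp_determines_split[OF distinct', of l us r] \<open>us \<noteq> []\<close>
          eq[OF false_at_carrier] by simp
    next
      assume "leaves l @ us = leaves l' \<and> leaves r = us @ leaves r'"
      then show False
        using eval_imp_determines_split[OF Node.prems(1), of l' us r'] \<open>us \<noteq> []\<close>
          eq[OF false_at_carrier] by simp
    qed
  qed
  with us have leaves_l: "leaves l = leaves l'" and leaves_r: "leaves r = leaves r'"
    by auto
  have disjoint: "set (leaves l) \<inter> set (leaves r) = {}"
    using Node.prems(1) by simp
  have "l = l'"
  proof (rule Node.IH(1))
    fix g :: "nat \<Rightarrow> nat" assume g: "\<And>i. g i \<in> {0, 1}"
    \<comment> \<open>Falsify both right subtrees without disturbing the left ones.\<close>
    define h where
      "h i = (if i \<in> set (leaves l) then g i else false_at {last (leaves r)} i)" for i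
    have h: "h i \<in> {0, 1}" for i
      using g false_at_carrier by (simp add: h_def)
    have "last (leaves r) \<notin> set (leaves l)"
      using disjoint by (metis disjoint_iff last_in_set leaves_nonempty)
    then have r0: "eval_imp h r = 0" "eval_imp h r' = 0"
      using Node.prems(1) disjoint leaves_r
      by (auto intro!: eval_imp_last_only_false simp: h_def false_at_def)
    have "eval_imp h l = eval_imp g l" "eval_imp h l' = eval_imp g l'"
      using leaves_l by (auto intro!: eval_tree_cong simp: h_def)
    then show "eval_imp g l = eval_imp g l'"
      using eq[of h, OF h] r0 eval_imp_carrier[of g l, OF g] eval_imp_carrier[of g l', OF g]
      by (auto simp: imp_op_def)
  qed (use Node.prems(1) leaves_l in simp_all)
  moreover have "r = r'"
  proof (rule Node.IH(2))
    fix g :: "nat \<Rightarrow> nat" assume g: "\<And>i. g i \<in> {0, 1}"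
    \<comment> \<open>Make both left subtrees true without disturbing the right ones.\<close>
    define h where "h i = (if i \<in> set (leaves l) then 1 else g i)" for i
    have h: "h i \<in> {0, 1}" for i
      using g by (simp add: h_def)
    have l1: "eval_imp h l = 1" "eval_imp h l' = 1"
      using leaves_l eval_imp_last_true[of h l] eval_imp_last_true[of h l']
      by (simp_all add: h_def)
    have "eval_imp h r = eval_imp g r" "eval_imp h r' = eval_imp g r'"
      using leaves_r disjoint by (auto intro!: eval_tree_cong simp: h_def)
    then show "eval_imp g r = eval_imp g r'"
      using eq[of h, OF h] l1 eval_imp_carrier[of g r, OF g] eval_imp_carrier[of g r', OF g]
      by (auto simp: imp_op_def)
  qed (use Node.prems(1) leaves_r in simp_all)
  ultimately show ?case
    using t' by simp
qed

theorem theorem3p5: "completely_dissociative {0, 1} imp_op"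
  unfolding completely_dissociative_def dissociative_def
proof (intro allI impI ballI)
  fix k u v
  assume "u \<in> formal_products k" "v \<in> formal_products k" "u \<noteq> v"
  then obtain s t where s: "u = postfix s" "leaves s = [0..<k]"
    and t: "v = postfix t" "leaves t = [0..<k]"
    by (metis formal_product_parse)
  with \<open>u \<noteq> v\<close> have "s \<noteq> t"
    by auto
  then show "\<exists>g. (\<forall>i. g i \<in> {0, 1}) \<and> rpn_value imp_op g u \<noteq> rpn_value imp_op g v"
    using eval_imp_inj[of s t] s t by (auto simp: rpn_value_postfix)
qed

end
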